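(* Let $K$ be any field with $\mathbb{Q}\subseteq K\subseteq\mathbb{C}$. Then $\mathbb{C}$ is $\sigma$-tame Galois over $K$.
   Context: An extension $L/K$ is $\sigma$-tame Galois if $L$ is an algebraic Galois extension of $K(\Delta)$ for every transcendence base $\Delta$ of $L/K$. *)

theory Defs
  imports "HOL-Algebra.Algebraic_Closure_Type" "HOL-Algebra.Generated_Fields" Complex_Main
begin

text \<open>
  A field extension \<open>L/K\<close> is a field record \<open>R\<close> (the role of \<open>L\<close>) together with a set \<open>K\<close>
  such that \<^prop>\<open>subfield K R\<close>.
\<close>

context ring
begin

text \<open>
  Indexed polynomials map monomials, encoded as multisets of indices, to coefficients. Here the
  indices are themselves elements of the ring, and \<open>X\<^sub>a\<close> is evaluated at \<open>a\<close>.
\<close>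

definition indexed_value :: "('a multiset \<Rightarrow> 'a) \<Rightarrow> 'a"
  where "indexed_value P =
    (\<Oplus>m\<in>{m. P m \<noteq> \<zero>}. P m \<otimes> (\<Otimes>a\<in>set_mset m. a [^] count m a))"

definition algebraically_independent :: "'a set \<Rightarrow> 'a set \<Rightarrow> bool"
  where "algebraically_independent K \<Delta> \<longleftrightarrow> \<Delta> \<subseteq> carrier R \<and>
    (\<forall>P \<in> indexed_pset \<Delta> K. indexed_value P = \<zero> \<longrightarrow> P = indexed_const \<zero>)"

definition transcendence_base :: "'a set \<Rightarrow> 'a set \<Rightarrow> bool"
  where "transcendence_base K \<Delta> \<longleftrightarrow> algebraically_independent K \<Delta> \<and>
    (\<forall>\<Delta>'. algebraically_independent K \<Delta>' \<and> \<Delta> \<subseteq> \<Delta>' \<longrightarrow> \<Delta>' = \<Delta>)"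

definition algebraic_extension :: "'a set \<Rightarrow> bool"
  where "algebraic_extension K \<longleftrightarrow> (\<forall>x \<in> carrier R. (algebraic over K) x)"

definition galois_group :: "'a set \<Rightarrow> ('a \<Rightarrow> 'a) set"
  where "galois_group K = {\<sigma> \<in> ring_iso R R. \<forall>k \<in> K. \<sigma> k = k}"

text \<open>
  The fixed-field notion of Galois, which also makes sense for transcendental extensions;
  for algebraic extensions it amounts to being normal and separable.
\<close>

definition galois_extension :: "'a set \<Rightarrow> bool"
  where "galois_extension K \<longleftrightarrow> {x \<in> carrier R. \<forall>\<sigma> \<in> galois_group K. \<sigma> x = x} = K"

definition sigma_tame_galois :: "'a set \<Rightarrow> bool"
  where "sigma_tame_galois K \<longleftrightarrow>
    (\<forall>\<Delta>. transcendence_base K \<Delta> \<longrightarrow>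
      algebraic_extension (generate_field R (K \<union> \<Delta>)) \<and>
      galois_extension (generate_field R (K \<union> \<Delta>)))"

end

abbreviation complex_field :: "complex ring"
  where "complex_field \<equiv> ring_of_type_algebra"

end

theory Submission
  imports Defs
begin

text \<open>
  If \<open>x\<close> is transcendental over \<open>K(\<Delta>)\<close>, then \<open>\<Delta> \<union> {x}\<close> is still algebraically independent, so for a
  transcendence base \<open>\<Delta>\<close> the field \<open>\<complex>\<close> is algebraic over \<open>F = K(\<Delta>)\<close>. Given \<open>x \<notin> F\<close>, the minimal
  polynomial of \<open>x\<close> over \<open>F\<close> is separable of degree at least two, hence has another root \<open>y\<close>. The
  \<open>F\<close>-embedding of \<open>F(x)\<close> with \<open>x \<mapsto> y\<close> extends by Zorn's lemma to an endomorphism of \<open>\<complex>\<close>, which is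
  an automorphism since \<open>\<complex>\<close> is algebraic over \<open>F\<close>. So \<open>F\<close> is the fixed field of its Galois group.
\<close>

section \<open>Extending homomorphisms of algebraic extensions\<close>

definition polys_over :: "'a::zero set \<Rightarrow> 'a poly set"
  where "polys_over F = {p. \<forall>i. coeff p i \<in> F}"

text \<open>Only the graph of the homomorphism is at hand, so applying it to coefficients becomes a
  relation: \<open>q\<close> is the image of \<open>p\<close>.\<close>

definition poly_rel :: "('a::zero \<times> 'a) set \<Rightarrow> 'a poly \<Rightarrow> 'a poly \<Rightarrow> bool"
  where "poly_rel G p q \<longleftrightarrow> (\<forall>i. (coeff p i, coeff q i) \<in> G)"

lemma degree_neq_0_if_root:
  assumes "p \<noteq> 0" "poly p x = 0"
  shows "degree p \<noteq> 0"
proof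
  assume "degree p = 0"
  then obtain c where "p = [:c:]" by (rule degree_eq_zeroE)
  then show False using assms by simp
qed

text \<open>A partial \<open>F\<close>-homomorphism is encoded by its graph \<open>G\<close>, a subring of the product ring, so that
  extension is inclusion and the union of a chain is an upper bound.\<close>

locale partial_hom =
  fixes F :: "'a::field set" and G :: "('a \<times> 'a) set"
  assumes zero_in: "0 \<in> F" and one_in: "1 \<in> F"
    and alg: "\<And>x. \<exists>p \<in> polys_over F. p \<noteq> 0 \<and> poly p x = 0"
    and diag: "\<And>c. c \<in> F \<Longrightarrow> (c, c) \<in> G"
    and add: "\<And>a b c d. (a, b) \<in> G \<Longrightarrow> (c, d) \<in> G \<Longrightarrow> (a + c, b + d) \<in> G"
    and mult: "\<And>a b c d. (a, b) \<in> G \<Longrightarrow> (c, d) \<in> G \<Longrightarrow> (a * c, b * d) \<in> G"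
    and uminus: "\<And>a b. (a, b) \<in> G \<Longrightarrow> (- a, - b) \<in> G"
    and zeroD: "\<And>b. (0, b) \<in> G \<Longrightarrow> b = 0"
begin

lemma diff: "(a, b) \<in> G \<Longrightarrow> (c, d) \<in> G \<Longrightarrow> (a - c, b - d) \<in> G"
  using add[OF _ uminus] by fastforce

text \<open>By additivity, single-valuedness reduces to the fibre over 0, which is why the locale
  only assumes \<open>zeroD\<close>.\<close>

lemma unique: "(a, b) \<in> G \<Longrightarrow> (a, c) \<in> G \<Longrightarrow> b = c"
  using diff[of a b a c] zeroD[of "b - c"] by simp

lemma sum_in: "(\<And>i. i \<in> I \<Longrightarrow> (f i, g i) \<in> G) \<Longrightarrow> (sum f I, sum g I) \<in> G"
  by (induction I rule: infinite_finite_induct) (auto intro: add diag zero_in)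

text \<open>Coefficients in \<open>F\<close> are fixed by \<open>diag\<close>, so evaluation
  commutes with the homomorphism; hence roots go to roots.\<close>

lemma poly_eval_rel:
  assumes "p \<in> polys_over F" "(a, b) \<in> G"
  shows "(poly p a, poly p b) \<in> G"
  using assms(1)
proof (induction p)
  case 0
  show ?case by (simp add: diag zero_in)
next
  case (pCons c p)
  have c: "c \<in> F" "p \<in> polys_over F"
    using pCons.prems unfolding polys_over_def by (auto simp: coeff_pCons split: nat.splits)
  show ?case
    using pCons.IH[OF c(2)] c(1) assms(2) by (auto intro!: add mult diag)
qed

text \<open>An algebraic element is a root of a polynomial with nonzero constant term, which forces the
  image of a nonzero element to be nonzero; hence no closure under inverses is needed.\<close>

lemma zeroD':
  assumes "(a, 0) \<in> G"
  shows "a = 0"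
proof (rule ccontr)
  assume a: "a \<noteq> 0"
  \<comment> \<open>Since \<open>a\<close> is nonzero, factors of the variable can be cancelled from
    \<open>f\<close> without losing the root.\<close>
  have "\<exists>g \<in> polys_over F. coeff g 0 \<noteq> 0 \<and> poly g a = 0"
    if "f \<in> polys_over F" "f \<noteq> 0" "poly f a = 0" for f
    using that
  proof (induction f)
    case (pCons c p)
    show ?case
    proof (cases "c = 0")
      case True
      have "p \<in> polys_over F"
        using pCons.prems unfolding polys_over_def by (auto simp: coeff_pCons split: nat.splits)
      then show ?thesis
        using pCons a True by auto
    next
      case False
      then show ?thesis using pCons.prems by (intro bexI[of _ "pCons c p"]) auto
    qed
  qed auto
  then obtain g where g: "g \<in> polys_over F" "coeff g 0 \<noteq> 0" "poly g a = 0"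
    using alg by blast
  have "(poly g a, poly g 0) \<in> G"
    by (rule poly_eval_rel[OF g(1) assms])
  then show False
    using g zeroD by (simp add: poly_0_coeff_0)
qed

lemma poly_rel_0: "poly_rel G 0 q \<Longrightarrow> q = 0"
  unfolding poly_rel_def by (simp add: poly_eq_iff zeroD)

lemma poly_rel_add: "poly_rel G p q \<Longrightarrow> poly_rel G r s \<Longrightarrow> poly_rel G (p + r) (q + s)"
  unfolding poly_rel_def by (auto intro: add)

lemma poly_rel_uminus: "poly_rel G p q \<Longrightarrow> poly_rel G (- p) (- q)"
  unfolding poly_rel_def by (auto intro: uminus)

lemma poly_rel_diff: "poly_rel G p q \<Longrightarrow> poly_rel G r s \<Longrightarrow> poly_rel G (p - r) (q - s)"
  unfolding poly_rel_def by (auto intro: diff)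

lemma poly_rel_mult: "poly_rel G p q \<Longrightarrow> poly_rel G r s \<Longrightarrow> poly_rel G (p * r) (q * s)"
  unfolding poly_rel_def by (auto simp: coeff_mult intro!: sum_in mult)

lemma poly_rel_monom: "(a, b) \<in> G \<Longrightarrow> poly_rel G (monom a n) (monom b n)"
  unfolding poly_rel_def by (auto intro: diag zero_in)

lemma poly_rel_coeff: "poly_rel G p q \<Longrightarrow> (coeff p i, coeff q i) \<in> G"
  unfolding poly_rel_def by auto

text \<open>Pseudo-division by the minimal polynomial: subtract the multiple that cancels the leading
  term and recurse on the degree.\<close>

lemma root_transfer:
  assumes m: "poly_rel G m m'" "m \<noteq> 0" "poly m z = 0"
    and minimal: "\<And>p q. poly_rel G p q \<Longrightarrow> p \<noteq> 0 \<Longrightarrow> poly p z = 0 \<Longrightarrow> degree m \<le> degree p"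
    and w: "poly m' w = 0"
    and pq: "poly_rel G p q" "poly p z = 0"
  shows "poly q w = 0"
  using pq
proof (induction "degree p" arbitrary: p q rule: less_induct)
  case less
  show ?case
  proof (cases "p = 0")
    case True
    then have "q = 0" using less.prems(1) by (simp add: poly_rel_0)
    then show ?thesis by simp
  next
    case False
    define k where "k = degree p - degree m"
    have le: "degree m \<le> degree p"
      using minimal less.prems False by blast
    define r where "r = monom (lead_coeff m) 0 * p - monom (lead_coeff p) k * m"
    \<comment> \<open>These coefficients are the partners of the leading ones of \<open>m\<close>
      and \<open>p\<close>, whatever the degrees of \<open>m'\<close> and \<open>q\<close>; thus
      \<open>s\<close> mirrors \<open>r\<close>.\<close>
    define s where "s = monom (coeff m' (degree m)) 0 * q - monom (coeff q (degree p)) k * m'"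
    have rs: "poly_rel G r s"
      unfolding r_def s_def using less.prems(1) m(1)
      by (intro poly_rel_diff poly_rel_mult poly_rel_monom poly_rel_coeff)
    \<comment> \<open>Only from positive degree does a vanishing top coefficient lower the
      degree.\<close>
    have "degree p \<noteq> 0"
      using False less.prems(2) by (rule degree_neq_0_if_root)
    moreover have "degree r \<le> degree p"
      unfolding r_def
    proof (rule degree_diff_le)
      show "degree (monom (lead_coeff m) 0 * p) \<le> degree p"
        by (simp add: monom_0)
      show "degree (monom (lead_coeff p) k * m) \<le> degree p"
        using False m(2) le by (simp add: degree_mult_eq degree_monom_eq k_def)
    qed
    moreover have "coeff r (degree p) = 0"
      using le by (simp add: r_def k_def coeff_monom_mult monom_0)
    ultimately have "degree r < degree p"
      by (metis leading_coeff_0_iff degree_0 le_neq_implies_less neq0_conv)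
    moreover have "poly r z = 0"
      using less.prems m(3) by (simp add: r_def)
    ultimately have "poly s w = 0"
      using less.hyps rs by blast
    \<comment> \<open>As \<open>w\<close> is a root of \<open>m'\<close>, \<open>poly s w\<close> is
      this coefficient times \<open>poly q w\<close>; being nonzero, it cancels.\<close>
    moreover have "coeff m' (degree m) \<noteq> 0"
      using zeroD'[of "lead_coeff m"] poly_rel_coeff[OF m(1), of "degree m"] m(2) by auto
    ultimately show ?thesis
      using w by (simp add: s_def poly_monom)
  qed
qed

text \<open>The extension must send \<open>poly p z\<close> to \<open>poly q w\<close> for related
  \<open>p\<close> and \<open>q\<close>. Only \<open>zeroD\<close>, which makes it well defined, is
  not formal; it is \<open>root_transfer\<close>.\<close>

lemma partial_hom_adjoin:
  assumes m: "poly_rel G m m'" "m \<noteq> 0" "poly m z = 0"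
    and minimal: "\<And>p q. poly_rel G p q \<Longrightarrow> p \<noteq> 0 \<Longrightarrow> poly p z = 0 \<Longrightarrow> degree m \<le> degree p"
    and w: "poly m' w = 0"
  obtains G' where "partial_hom F G'" "G \<subseteq> G'" "(z, w) \<in> G'"
proof -
  define G' where "G' = {(poly p z, poly q w) | p q. poly_rel G p q}"
  have I: "(poly p z, poly q w) \<in> G'" if "poly_rel G p q" for p q
    using that unfolding G'_def by blast
  have const: "(a, b) \<in> G'" if "(a, b) \<in> G" for a b
    using I[OF poly_rel_monom[OF that, of 0]] by (simp add: poly_monom)
  have "(z, w) \<in> G'"
    using I[OF poly_rel_monom[OF diag[OF one_in], of 1]] by (simp add: poly_monom)
  moreover have "partial_hom F G'"
  proof
    fix a b c d
    assume "(a, b) \<in> G'" "(c, d) \<in> G'"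
    then obtain p q r s where "poly_rel G p q" "poly_rel G r s"
      "a = poly p z" "b = poly q w" "c = poly r z" "d = poly s w"
      unfolding G'_def by blast
    then show "(a + c, b + d) \<in> G'" "(a * c, b * d) \<in> G'"
      using I[OF poly_rel_add] I[OF poly_rel_mult] by force+
  next
    fix a b
    assume "(a, b) \<in> G'"
    then obtain p q where "poly_rel G p q" "a = poly p z" "b = poly q w"
      unfolding G'_def by blast
    then show "(- a, - b) \<in> G'"
      using I[OF poly_rel_uminus] by force
  next
    fix b
    assume "(0, b) \<in> G'"
    then show "b = 0"
      unfolding G'_def using root_transfer[OF m minimal w] by fastforce
  qed (use zero_in one_in alg const diag in auto)
  moreover have "G \<subseteq> G'" using const by auto
  ultimately show thesis
    using that by blast
qed

end

text \<open>A polynomial of least degree over the domain of \<open>G\<close> acts as minimal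
  polynomial of \<open>z\<close>; algebraic closedness gives its image a root
  \<open>w\<close>.\<close>

lemma partial_hom_step:
  fixes F :: "'a::alg_closed_field set"
  assumes "partial_hom F G"
  obtains G' w where "partial_hom F G'" "G \<subseteq> G'" "(z, w) \<in> G'"
proof -
  interpret partial_hom F G by fact
  define S where "S = {p. (\<exists>q. poly_rel G p q) \<and> p \<noteq> 0 \<and> poly p z = 0}"
  obtain f where "f \<in> polys_over F" "f \<noteq> 0" "poly f z = 0"
    using alg by blast
  then have "f \<in> S"
    unfolding S_def poly_rel_def polys_over_def using diag by blast
  then obtain m where m: "m \<in> S" "\<And>p. p \<in> S \<Longrightarrow> degree m \<le> degree p"
    using exists_least_iff[of "\<lambda>n. \<exists>p\<in>S. degree p = n"] by (metis not_less)
  obtain m' where m': "poly_rel G m m'" "m \<noteq> 0" "poly m z = 0"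
    using m(1) unfolding S_def by blast
  have "degree m \<noteq> 0"
    using m'(2,3) by (rule degree_neq_0_if_root)
  \<comment> \<open>Injectivity keeps this coefficient nonzero at a positive index, so
    \<open>m'\<close> is not constant.\<close>
  moreover have "coeff m' (degree m) \<noteq> 0"
    using zeroD'[of "lead_coeff m"] poly_rel_coeff[OF m'(1), of "degree m"] m'(2) by auto
  ultimately have "degree m' > 0"
    using le_degree by fastforce
  then obtain w where "poly m' w = 0"
    using alg_closed_imp_poly_has_root by blast
  moreover have "degree m \<le> degree p" if "poly_rel G p q" "p \<noteq> 0" "poly p z = 0" for p q
    using m(2) that unfolding S_def by blast
  ultimately obtain G' where "partial_hom F G'" "G \<subseteq> G'" "(z, w) \<in> G'"
    using partial_hom_adjoin[OF m'] by metis
  then show thesis by (rule that)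
qed

text \<open>Each closure condition involves at most two pairs, and these lie in one member of the
  chain; nonemptiness supplies the diagonal.\<close>

lemma partial_hom_Union_chain:
  assumes "C \<noteq> {}" "\<And>G. G \<in> C \<Longrightarrow> partial_hom F G" "\<And>G H. G \<in> C \<Longrightarrow> H \<in> C \<Longrightarrow> G \<subseteq> H \<or> H \<subseteq> G"
  shows "partial_hom F (\<Union>C)"
proof -
  obtain G where G: "G \<in> C" using assms(1) by blast
  interpret partial_hom F G by (rule assms(2)[OF G])
  show ?thesis
  proof
    fix a b c d
    assume "(a, b) \<in> \<Union>C" "(c, d) \<in> \<Union>C"
    then obtain H where H: "H \<in> C" "(a, b) \<in> H" "(c, d) \<in> H"
      using assms(3) by blast
    then show "(a + c, b + d) \<in> \<Union>C" "(a * c, b * d) \<in> \<Union>C"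
      using partial_hom.add[OF assms(2)[OF H(1)]] partial_hom.mult[OF assms(2)[OF H(1)]] by blast+
  next
    fix a b assume "(a, b) \<in> \<Union>C"
    then show "(- a, - b) \<in> \<Union>C" using partial_hom.uminus[OF assms(2)] by blast
  next
    fix b assume "(0, b) \<in> \<Union>C"
    then show "b = 0" using partial_hom.zeroD[OF assms(2)] by blast
  qed (use G zero_in one_in alg diag in auto)
qed

text \<open>A graph that is maximal by Zorn's lemma is total, for \<open>partial_hom_step\<close>
  would enlarge it at a missing point.\<close>

lemma partial_hom_extend_total:
  fixes F :: "'a::alg_closed_field set"
  assumes "partial_hom F G"
  obtains M where "partial_hom F M" "G \<subseteq> M" "\<And>x. \<exists>y. (x, y) \<in> M"
proof -
  define A where "A = {H. partial_hom F H \<and> G \<subseteq> H}"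
  have "\<exists>M\<in>A. \<forall>H\<in>A. M \<subseteq> H \<longrightarrow> H = M"
  proof (rule subset_Zorn_nonempty)
    show "A \<noteq> {}" using assms unfolding A_def by blast
    fix C assume C: "C \<noteq> {}" "subset.chain A C"
    then have "C \<subseteq> A" "\<And>G H. G \<in> C \<Longrightarrow> H \<in> C \<Longrightarrow> G \<subseteq> H \<or> H \<subseteq> G"
      by (auto simp: subset_chain_def)
    then show "\<Union>C \<in> A"
      using partial_hom_Union_chain[OF C(1), of F] C(1) unfolding A_def by blast
  qed
  then obtain M where M: "M \<in> A" "\<And>H. H \<in> A \<Longrightarrow> M \<subseteq> H \<Longrightarrow> H = M" by blast
  have "\<exists>y. (x, y) \<in> M" for x
  proof -
    have "partial_hom F M" using M(1) unfolding A_def by blast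
    then obtain H w where H: "partial_hom F H" "M \<subseteq> H" "(x, w) \<in> H"
      by (rule partial_hom_step)
    then have "H = M" using M unfolding A_def by blast
    then show ?thesis using H by blast
  qed
  then show thesis using that M(1) unfolding A_def by blast
qed

text \<open>Surjectivity: an injective endomorphism over \<open>F\<close> permutes the finite set of roots of any
  nonzero polynomial over \<open>F\<close>.\<close>

lemma partial_hom_total_bij:
  assumes "partial_hom F M" "\<And>x. \<exists>y. (x, y) \<in> M"
  obtains \<sigma> where "bij \<sigma>" "\<And>x. (x, \<sigma> x) \<in> M"
proof -
  interpret partial_hom F M by fact
  obtain \<sigma> where \<sigma>: "(x, \<sigma> x) \<in> M" for x
    using assms(2) by metis
  have "inj \<sigma>"
  proof (rule injI)
    fix x y assume "\<sigma> x = \<sigma> y"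
    then show "x = y" using diff[OF \<sigma>[of x] \<sigma>[of y]] zeroD'[of "x - y"] by simp
  qed
  moreover have "z \<in> range \<sigma>" for z
  proof -
    obtain f where f: "f \<in> polys_over F" "f \<noteq> 0" "poly f z = 0"
      using alg by blast
    have "\<sigma> ` {x. poly f x = 0} \<subseteq> {x. poly f x = 0}"
      using poly_eval_rel[OF f(1) \<sigma>] zeroD by (auto, metis)
    then have "\<sigma> ` {x. poly f x = 0} = {x. poly f x = 0}"
      using \<open>inj \<sigma>\<close> poly_roots_finite[OF f(2)]
      by (intro endo_inj_surj) (auto intro: inj_on_subset)
    then show ?thesis using f(3) by blast
  qed
  ultimately have "bij \<sigma>" unfolding bij_def by blast
  then show thesis using that \<sigma> by blast
qed

section \<open>Separability and automorphisms moving a given element\<close>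

text \<open>In characteristic 0 the derivative of \<open>m\<close> is nonzero of smaller degree, so
  by minimality \<open>x\<close> is a simple root; the cofactor \<open>g\<close> then supplies the
  other root.\<close>

lemma exists_other_root:
  fixes F :: "'a::{alg_closed_field, field_char_0} set"
  assumes F: "0 \<in> F" "1 \<in> F" "\<And>a b. a \<in> F \<Longrightarrow> b \<in> F \<Longrightarrow> a + b \<in> F"
    "\<And>a b. a \<in> F \<Longrightarrow> b \<in> F \<Longrightarrow> a * b \<in> F" "\<And>a. a \<in> F \<Longrightarrow> - a \<in> F"
    "\<And>a. a \<in> F \<Longrightarrow> inverse a \<in> F"
    and m: "m \<in> polys_over F" "m \<noteq> 0" "poly m x = 0"
    and minimal: "\<And>p. p \<in> polys_over F \<Longrightarrow> p \<noteq> 0 \<Longrightarrow> poly p x = 0 \<Longrightarrow> degree m \<le> degree p"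
    and x: "x \<notin> F"
  obtains y where "poly m y = 0" "y \<noteq> x"
proof -
  obtain g where g: "m = [:- x, 1:] * g"
    using m(3) by (auto simp: poly_eq_0_iff_dvd)
  have g0: "g \<noteq> 0" using g m(2) by auto
  then have deg: "degree m = Suc (degree g)"
    unfolding g by (subst degree_mult_eq) auto
  \<comment> \<open>Differentiation multiplies coefficients by natural numbers, which must therefore
    lie in \<open>F\<close>.\<close>
  have "of_nat n \<in> F" for n
    by (induction n) (auto simp: F)
  then have "pderiv m \<in> polys_over F"
    using m(1) F(4) unfolding polys_over_def by (auto simp: coeff_pderiv simp del: of_nat_Suc)
  moreover have "pderiv m \<noteq> 0" using deg by (simp add: pderiv_eq_0_iff)
  moreover have "degree (pderiv m) < degree m" using deg by (simp add: degree_pderiv)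
  ultimately have "poly (pderiv m) x \<noteq> 0" using minimal by fastforce
  \<comment> \<open>At \<open>x\<close> the derivative of \<open>[:- x, 1:] * g\<close> equals
    \<open>poly g x\<close>.\<close>
  then have gx: "poly g x \<noteq> 0"
    unfolding g pderiv_mult by (simp add: pderiv_pCons)
  have "degree g \<noteq> 0"
  proof
    assume "degree g = 0"
    then obtain c where c: "g = [:c:]" by (rule degree_eq_zeroE)
    \<comment> \<open>A constant \<open>g\<close> would make \<open>x\<close>, up to sign, a
      quotient of two coefficients of \<open>m\<close>, hence an element of
      \<open>F\<close>.\<close>
    then have "coeff m 0 = - (x * c)" "coeff m 1 = c" by (auto simp: g)
    then have "x * c \<in> F" "c \<in> F" using m(1) F(5) unfolding polys_over_def
      by (metis (mono_tags, lifting) mem_Collect_eq minus_minus)+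
    then have "x * c * inverse c \<in> F" using F(4)[OF _ F(6)] by blast
    moreover have "c \<noteq> 0" using c g0 by auto
    ultimately show False using x by (simp add: mult.assoc)
  qed
  then obtain y where "poly g y = 0"
    using alg_closed_imp_poly_has_root by blast
  then show thesis using that[of y] gx g by auto
qed

text \<open>The identity on \<open>F\<close> is extended so that \<open>x\<close> goes to another
  root \<open>y\<close>, then to the whole field, where algebraicity makes it bijective.\<close>

lemma exists_automorphism_moving:
  fixes F :: "'a::{alg_closed_field, field_char_0} set"
  assumes F: "0 \<in> F" "1 \<in> F" "\<And>a b. a \<in> F \<Longrightarrow> b \<in> F \<Longrightarrow> a + b \<in> F"
    "\<And>a b. a \<in> F \<Longrightarrow> b \<in> F \<Longrightarrow> a * b \<in> F" "\<And>a. a \<in> F \<Longrightarrow> - a \<in> F"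
    "\<And>a. a \<in> F \<Longrightarrow> inverse a \<in> F"
    and alg: "\<And>x. \<exists>p \<in> polys_over F. p \<noteq> 0 \<and> poly p x = 0"
    and x: "x \<notin> F"
  obtains \<sigma> where "bij \<sigma>" "\<And>a b. \<sigma> (a + b) = \<sigma> a + \<sigma> b" "\<And>a b. \<sigma> (a * b) = \<sigma> a * \<sigma> b"
    "\<And>c. c \<in> F \<Longrightarrow> \<sigma> c = c" "\<sigma> x \<noteq> x"
proof -
  define S where "S = {p \<in> polys_over F. p \<noteq> 0 \<and> poly p x = 0}"
  have "S \<noteq> {}" using alg unfolding S_def by blast
  then obtain m where "m \<in> S" and min: "\<And>p. p \<in> S \<Longrightarrow> degree m \<le> degree p"
    using exists_least_iff[of "\<lambda>n. \<exists>p\<in>S. degree p = n"] by (metis not_less ex_in_conv)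
  then have m: "m \<in> polys_over F" "m \<noteq> 0" "poly m x = 0" unfolding S_def by auto
  have "\<And>p. p \<in> polys_over F \<Longrightarrow> p \<noteq> 0 \<Longrightarrow> poly p x = 0 \<Longrightarrow> degree m \<le> degree p"
    using min unfolding S_def by blast
  then obtain y where y: "poly m y = 0" "y \<noteq> x"
    using exists_other_root[OF F m _ x] by blast
  interpret id: partial_hom F "Id_on F"
    by unfold_locales (use F alg in auto)
  \<comment> \<open>For the identity graph, minimality among related pairs is minimality over
    \<open>F\<close>, and \<open>m\<close> is its own image.\<close>
  have rel: "poly_rel (Id_on F) p q \<longleftrightarrow> p \<in> polys_over F \<and> p = q" for p q
    unfolding poly_rel_def polys_over_def by (auto simp: Id_on_iff poly_eq_iff)
  obtain G where G: "partial_hom F G" "(x, y) \<in> G"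
  proof (rule id.partial_hom_adjoin[of m m x y])
    show "degree m \<le> degree p" if "poly_rel (Id_on F) p q" "p \<noteq> 0" "poly p x = 0" for p q
      using min that unfolding rel S_def by blast
  qed (use m y rel in auto)
  obtain M where M: "partial_hom F M" "G \<subseteq> M" "\<And>x. \<exists>y. (x, y) \<in> M"
    using partial_hom_extend_total[OF G(1)] by blast
  then obtain \<sigma> where \<sigma>: "bij \<sigma>" "\<And>x. (x, \<sigma> x) \<in> M"
    using partial_hom_total_bij by blast
  interpret M: partial_hom F M by fact
  have eq: "\<sigma> a = b" if "(a, b) \<in> M" for a b
    using M.unique[OF that \<sigma>(2)] by simp
  show thesis
  proof (rule that[OF \<sigma>(1)])
    show "\<sigma> x \<noteq> x" using eq[of x y] G(2) M(2) y(2) by auto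
  qed (auto intro!: eq M.add M.mult M.diag \<sigma>(2))
qed

section \<open>Type-based fields as ring records\<close>

lemma ring_of_type_algebra_simps [simp]:
  "carrier ring_of_type_algebra = UNIV"
  "x \<otimes>\<^bsub>ring_of_type_algebra\<^esub> y = x * y"
  "x \<oplus>\<^bsub>ring_of_type_algebra\<^esub> y = x + y"
  "\<one>\<^bsub>ring_of_type_algebra\<^esub> = 1"
  "\<zero>\<^bsub>ring_of_type_algebra\<^esub> = 0"
  by (simp_all add: ring_of_type_algebra_def)

context
begin

private abbreviation (input) L :: "'a::field ring" where "L \<equiv> ring_of_type_algebra"

interpretation L: field "L :: 'a::field ring" by rule

lemma a_inv_type: "\<ominus>\<^bsub>L\<^esub> x = - x"
  using L.minus_equality[of "- x" x] by simp

lemma m_inv_type: "x \<noteq> 0 \<Longrightarrow> inv\<^bsub>L\<^esub> x = inverse x"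
  using L.inv_char[of x "inverse x"] by simp

lemma nat_pow_type: "x [^]\<^bsub>L\<^esub> (n::nat) = x ^ n"
  by (induction n) (auto simp: mult.commute)

lemma finsum_type: "finsum L f A = sum f A"
proof (induction A rule: infinite_finite_induct)
  \<comment> \<open>Both sums default to 0 on infinite sets.\<close>
  case (infinite A)
  then show ?case by (simp add: finsum_def finprod_def)
qed auto

lemma finprod_type: "finprod L f A = prod f A"
proof (induction A rule: infinite_finite_induct)
  case (infinite A)
  then show ?case by (simp add: finprod_def)
qed auto

text \<open>List polynomials put the leading coefficient first, \<open>Poly\<close> the constant
  one; hence the reversal.\<close>

lemma eval_type: "L.eval p x = poly (Poly (rev p)) x"
  by (induction p) (auto simp: nat_pow_type Poly_append poly_monom)

lemma subfield_type_closed: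
  assumes "subfield F L"
  shows "0 \<in> F" "1 \<in> F" "a \<in> F \<Longrightarrow> b \<in> F \<Longrightarrow> a + b \<in> F" "a \<in> F \<Longrightarrow> b \<in> F \<Longrightarrow> a * b \<in> F"
    "a \<in> F \<Longrightarrow> - a \<in> F" "a \<in> F \<Longrightarrow> inverse a \<in> F"
proof -
  note sub = subringE[OF subfieldE(1)[OF assms]]
  show "0 \<in> F" using sub(2) by simp
  \<comment> \<open>The convention \<open>inverse 0 = 0\<close> covers zero.\<close>
  then show "a \<in> F \<Longrightarrow> inverse a \<in> F"
    using L.subfield_m_inv(1)[OF assms, of a] m_inv_type[of a] by (cases "a = 0") auto
  show "1 \<in> F" "a \<in> F \<Longrightarrow> b \<in> F \<Longrightarrow> a + b \<in> F" "a \<in> F \<Longrightarrow> b \<in> F \<Longrightarrow> a * b \<in> F"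
    "a \<in> F \<Longrightarrow> - a \<in> F"
    using sub(3) sub(5)[of a] sub(6,7)[of a b] by (auto simp: a_inv_type)
qed

lemma algebraic_over_type_iff:
  assumes F: "subfield F L"
  shows "(L.algebraic over F) x \<longleftrightarrow> (\<exists>p \<in> polys_over F. p \<noteq> 0 \<and> poly p x = 0)"
proof
  assume "(L.algebraic over F) x"
  then obtain p where p: "p \<in> carrier (F[X]\<^bsub>L\<^esub>)" "p \<noteq> []" "L.eval p x = 0"
    using L.algebraicE[OF subfieldE(1)[OF F], of x] by auto
  then have "set p \<subseteq> F" "hd p \<noteq> 0"
    by (auto simp: univ_poly_def polynomial_def)
  then have "Poly (rev p) \<in> polys_over F" "Poly (rev p) \<noteq> 0"
    using p(2) subfield_type_closed(1)[OF F]
    by (auto simp: polys_over_def coeff_Poly_eq nth_default_def rev_nth Poly_eq_0 hd_in_set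
        rev_swap subset_iff)
  then show "\<exists>p \<in> polys_over F. p \<noteq> 0 \<and> poly p x = 0"
    using p(3) eval_type by metis
next
  assume "\<exists>p \<in> polys_over F. p \<noteq> 0 \<and> poly p x = 0"
  then obtain p where p: "p \<in> polys_over F" "p \<noteq> 0" "poly p x = 0" by blast
  show "(L.algebraic over F) x"
  proof (rule L.algebraicI)
    have "set (coeffs p) \<subseteq> F"
      using p(1) by (auto simp: polys_over_def coeffs_def)
    then show "rev (coeffs p) \<in> carrier (F[X]\<^bsub>L\<^esub>)"
      using p(2) by (auto simp: univ_poly_def polynomial_def hd_rev last_coeffs_eq_coeff_degree)
    show "L.eval (rev (coeffs p)) x = \<zero>\<^bsub>L\<^esub>"
      using p(3) by (simp add: eval_type)
  qed (use p(2) in auto)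
qed

section \<open>Indexed polynomials described by their supports\<close>

lemma indexed_const_zero_type: "L.indexed_const 0 = (\<lambda>_. 0)"
  by (auto simp: L.indexed_const_def)

lemma indexed_value_type:
  assumes "finite S" "{m. P m \<noteq> 0} \<subseteq> S"
  shows "L.indexed_value P = (\<Sum>m\<in>S. P m * prod_mset m)"
proof -
  have "L.indexed_value P = (\<Sum>m\<in>{m. P m \<noteq> 0}. P m * prod_mset m)"
    unfolding L.indexed_value_def
    by (simp add: finsum_type finprod_type nat_pow_type prod_mset_multiplicity)
  also have "\<dots> = (\<Sum>m\<in>S. P m * prod_mset m)"
    using assms by (intro sum.mono_neutral_left) auto
  finally show ?thesis .
qed

text \<open>The inductive description is traded for one by support, so that slices of a polynomial
  can be recognised as polynomials directly.\<close>

lemma indexed_pset_type_iff: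
  fixes K :: "'a::field set"
  assumes K: "subfield K L"
  shows "P \<in> L.indexed_pset I K \<longleftrightarrow>
    finite {m. P m \<noteq> 0} \<and> (\<forall>m. P m \<in> K) \<and> (\<forall>m. P m \<noteq> 0 \<longrightarrow> set_mset m \<subseteq> I)"
proof
  assume "P \<in> L.indexed_pset I K"
  then show "finite {m. P m \<noteq> 0} \<and> (\<forall>m. P m \<in> K) \<and> (\<forall>m. P m \<noteq> 0 \<longrightarrow> set_mset m \<subseteq> I)"
  proof (induction rule: L.indexed_pset.induct)
    case (indexed_const k)
    then show ?case
      using subfield_type_closed(1)[OF K]
      by (auto simp: L.indexed_const_def intro: finite_subset[of _ "{{#}}"])
  next
    case (indexed_padd P Q)
    have "{m. P m + Q m \<noteq> 0} \<subseteq> {m. P m \<noteq> 0} \<union> {m. Q m \<noteq> 0}" by auto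
    then have "finite {m. P m + Q m \<noteq> 0}"
      using indexed_padd.IH finite_subset by blast
    then show ?case
      using indexed_padd.IH subfield_type_closed(3)[OF K]
      by (auto simp: L.indexed_padd_def subset_iff) (metis add_0)
  next
    case (indexed_pmult P i)
    have "{m. L.indexed_pmult P i m \<noteq> 0} \<subseteq> add_mset i ` {m. P m \<noteq> 0}"
    proof
      fix m assume "m \<in> {m. L.indexed_pmult P i m \<noteq> 0}"
      then have "i \<in># m" "P (m - {#i#}) \<noteq> 0"
        by (auto simp: L.indexed_pmult_def split: if_splits)
      then show "m \<in> add_mset i ` {m. P m \<noteq> 0}"
        by (intro image_eqI[of _ _ "m - {#i#}"]) auto
    qed
    then have "finite {m. L.indexed_pmult P i m \<noteq> 0}"
      using indexed_pmult.IH finite_subset by blast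
    moreover have "set_mset m \<subseteq> I" if "L.indexed_pmult P i m \<noteq> 0" for m
    proof -
      have "i \<in># m" "P (m - {#i#}) \<noteq> 0"
        using that by (auto simp: L.indexed_pmult_def split: if_splits)
      then have "set_mset (m - {#i#}) \<subseteq> I" "m = add_mset i (m - {#i#})"
        using indexed_pmult.IH by auto
      then show ?thesis using indexed_pmult.hyps(2) by (metis insert_subset set_mset_add_mset_insert)
    qed
    ultimately show ?case
      using indexed_pmult.IH subfield_type_closed(1)[OF K]
      by (auto simp: L.indexed_pmult_def)
  qed
next
  \<comment> \<open>Conversely, \<open>P\<close> is rebuilt from monomials, each made from a
    constant by multiplying by one index at a time.\<close>
  have monomial: "(\<lambda>m. if m = n then c else 0) \<in> L.indexed_pset I K"
    if "c \<in> K" "set_mset n \<subseteq> I" for c n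
    using that(2)
  proof (induction n)
    case empty
    show ?case
      using L.indexed_pset.indexed_const[OF that(1), of I]
      by (simp add: L.indexed_const_def cong: if_cong)
  next
    case (add i n)
    have "L.indexed_pmult (\<lambda>m. if m = n then c else 0) i \<in> L.indexed_pset I K"
      using add by (intro L.indexed_pset.indexed_pmult) auto
    moreover have "L.indexed_pmult (\<lambda>m. if m = n then c else 0) i =
        (\<lambda>m. if m = add_mset i n then c else 0)"
      by (auto simp: L.indexed_pmult_def fun_eq_iff dest: multi_member_split)
    ultimately show ?case by simp
  qed
  assume P: "finite {m. P m \<noteq> 0} \<and> (\<forall>m. P m \<in> K) \<and> (\<forall>m. P m \<noteq> 0 \<longrightarrow> set_mset m \<subseteq> I)"
  have "(\<lambda>m. if m \<in> S then P m else 0) \<in> L.indexed_pset I K" if "finite S" "S \<subseteq> {m. P m \<noteq> 0}" for S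
    using that
  proof (induction S)
    case empty
    show ?case
      using L.indexed_pset.indexed_const[OF subfield_type_closed(1)[OF K], of I]
      by (simp add: indexed_const_zero_type)
  next
    case (insert n S)
    have "L.indexed_padd (\<lambda>m. if m \<in> S then P m else 0) (\<lambda>m. if m = n then P n else 0)
        \<in> L.indexed_pset I K"
      using insert P by (intro L.indexed_pset.indexed_padd monomial) auto
    moreover have "L.indexed_padd (\<lambda>m. if m \<in> S then P m else 0) (\<lambda>m. if m = n then P n else 0)
        = (\<lambda>m. if m \<in> insert n S then P m else 0)"
      using insert.hyps by (auto simp: L.indexed_padd_def fun_eq_iff)
    ultimately show ?case by simp
  qed
  from this[of "{m. P m \<noteq> 0}"] have "(\<lambda>m. if P m \<noteq> 0 then P m else 0) \<in> L.indexed_pset I K"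
    using P by simp
  moreover have "(\<lambda>m. if P m \<noteq> 0 then P m else 0) = P" by auto
  ultimately show "P \<in> L.indexed_pset I K" by simp
qed

section \<open>Transcendence bases\<close>

text \<open>A relation over \<open>insert x \<Delta>\<close> is sorted by powers of \<open>x\<close>, the coefficients being values of
  indexed polynomials over \<open>\<Delta>\<close>.\<close>

lemma algebraically_independent_insert:
  fixes K :: "'a::field set"
  assumes K: "subfield K L" and F: "subfield F L" and KF: "K \<union> \<Delta> \<subseteq> F"
    and indep: "L.algebraically_independent K \<Delta>"
    and trans: "\<And>p. p \<in> polys_over F \<Longrightarrow> poly p x = 0 \<Longrightarrow> p = 0"
  shows "L.algebraically_independent K (insert x \<Delta>)"
proof -
  note F_closed = subfield_type_closed[OF F]
  have "P = (\<lambda>_. 0)" if P: "P \<in> L.indexed_pset (insert x \<Delta>) K" "L.indexed_value P = 0" for P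
  proof -
    define S where "S = {m. P m \<noteq> 0}"
    have S: "finite S" "\<And>m. P m \<in> K" "\<And>m. m \<in> S \<Longrightarrow> set_mset m \<subseteq> insert x \<Delta>"
      using P(1) unfolding indexed_pset_type_iff[OF K] S_def by auto
    \<comment> \<open>\<open>Q j\<close> is the coefficient of the \<open>j\<close>-th power of the
      variable \<open>x\<close>; its monomials are free of \<open>x\<close>.\<close>
    define Q where "Q j m = (if x \<in># m then 0 else P (m + replicate_mset j x))" for j m
    define T where "T j = (\<lambda>m. m - replicate_mset j x) ` S" for j
    have T: "finite (T j)" "{m. Q j m \<noteq> 0} \<subseteq> T j" for j
    proof -
      show "finite (T j)" unfolding T_def using S(1) by simp
      show "{m. Q j m \<noteq> 0} \<subseteq> T j"
      proof
        fix m assume "m \<in> {m. Q j m \<noteq> 0}"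
        then have "m + replicate_mset j x \<in> S" by (auto simp: Q_def S_def split: if_splits)
        then show "m \<in> T j" unfolding T_def by (rule rev_image_eqI) simp
      qed
    qed
    have Q: "Q j \<in> L.indexed_pset \<Delta> K" for j
      unfolding indexed_pset_type_iff[OF K]
    proof (intro conjI allI impI)
      show "finite {m. Q j m \<noteq> 0}" using T finite_subset by blast
      show "Q j m \<in> K" for m
        using S(2) subfield_type_closed(1)[OF K] by (simp add: Q_def)
      show "set_mset m \<subseteq> \<Delta>" if "Q j m \<noteq> 0" for m
        using that S(3)[of "m + replicate_mset j x"] by (auto simp: Q_def S_def split: if_splits)
    qed
    define v where "v j = L.indexed_value (Q j)" for j
    have vF: "v j \<in> F" for j
    proof -
      have prod: "prod_mset m \<in> F" if "set_mset m \<subseteq> F" for m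
        using that by (induction m) (auto intro: F_closed)
      have sum: "sum f A \<in> F" if "\<And>a. a \<in> A \<Longrightarrow> f a \<in> F" for f :: "'a multiset \<Rightarrow> 'a" and A
        using that by (induction A rule: infinite_finite_induct) (auto intro: F_closed)
      have "Q j m * prod_mset m \<in> F" if "Q j m \<noteq> 0" for m
        using Q[of j] that KF unfolding indexed_pset_type_iff[OF K]
        by (intro F_closed prod) blast+
      then have "Q j m * prod_mset m \<in> F" for m
        using F_closed(1) by (cases "Q j m = 0") auto
      then show ?thesis
        unfolding v_def indexed_value_type[OF T] by (rule sum)
    qed
    have slice: "(\<Sum>m\<in>{m\<in>S. count m x = j}. P m * prod_mset m) = v j * x ^ j" for j
    proof -
      have "v j * x ^ j = (\<Sum>m\<in>{m. Q j m \<noteq> 0}. Q j m * prod_mset m * x ^ j)"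
        unfolding v_def
        by (subst indexed_value_type[of "{m. Q j m \<noteq> 0}"])
          (use finite_subset[OF T(2) T(1)] in \<open>auto simp: sum_distrib_right\<close>)
      also have "\<dots> = (\<Sum>m\<in>{m\<in>S. count m x = j}. P m * prod_mset m)"
      \<comment> \<open>Adding and removing \<open>j\<close> copies of \<open>x\<close> match the
        monomials of \<open>Q j\<close> with those of \<open>P\<close> having exponent
        \<open>j\<close> at \<open>x\<close>.\<close>
      proof (rule sum.reindex_bij_witness[of _ "\<lambda>m. m - replicate_mset j x" "\<lambda>m. m + replicate_mset j x"])
        fix m assume "m \<in> {m\<in>S. count m x = j}"
        then have m: "m \<in> S" "count m x = j" by auto
        then have sub: "m - replicate_mset j x + replicate_mset j x = m"
          by (auto simp: multiset_eq_iff)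
        then show "m - replicate_mset j x + replicate_mset j x = m" .
        have "x \<notin># m - replicate_mset j x"
          using m by (simp add: not_in_iff)
        then show "m - replicate_mset j x \<in> {m. Q j m \<noteq> 0}"
          using m sub by (simp add: Q_def S_def)
      next
        fix m assume "m \<in> {m. Q j m \<noteq> 0}"
        then have m: "x \<notin># m" "m + replicate_mset j x \<in> S" "Q j m = P (m + replicate_mset j x)"
          by (auto simp: Q_def S_def split: if_splits)
        then show "m + replicate_mset j x \<in> {m\<in>S. count m x = j}"
          by (simp add: not_in_iff)
        show "P (m + replicate_mset j x) * prod_mset (m + replicate_mset j x) =
            Q j m * prod_mset m * x ^ j"
          using m by (simp add: mult.assoc)
      qed auto
      finally show ?thesis by simp
    qed
    \<comment> \<open>\<open>N\<close> exceeds every exponent of \<open>x\<close>; the inserted 0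
      keeps \<open>Max\<close> meaningful for empty \<open>S\<close>.\<close>
    define N where "N = Suc (Max (insert 0 ((\<lambda>m. count m x) ` S)))"
    have N: "count m x < N" if "m \<in> S" for m
      unfolding N_def less_Suc_eq_le using S(1) that by (intro Max_ge) auto
    define q where "q = (\<Sum>j<N. monom (v j) j)"
    have coeff_q: "coeff q i = (if i < N then v i else 0)" for i
      unfolding q_def by (simp add: coeff_sum)
    have "poly q x = (\<Sum>j<N. v j * x ^ j)"
      unfolding q_def by (simp add: poly_sum poly_monom)
    \<comment> \<open>Grouping the monomials of \<open>P\<close> by their exponent at
      \<open>x\<close> identifies \<open>poly q x\<close> with the value of
      \<open>P\<close>.\<close>
    also have "\<dots> = (\<Sum>m\<in>S. P m * prod_mset m)"
      unfolding slice[symmetric] using S(1) N by (intro sum.group) auto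
    also have "\<dots> = 0"
      using P(2) indexed_value_type[OF S(1), of P] by (simp add: S_def)
    finally have "q = 0"
      using vF F_closed(1) by (intro trans) (auto simp: polys_over_def coeff_q)
    then have "v j = 0" if "j < N" for j
      using coeff_q[of j] that by simp
    \<comment> \<open>Independence of \<open>\<Delta>\<close> turns vanishing values into vanishing
      slices.\<close>
    then have Q0: "Q j = (\<lambda>_. 0)" if "j < N" for j
      using indep Q that unfolding L.algebraically_independent_def L.indexed_zero_def v_def by simp
    have "P m = 0" for m
    proof (rule ccontr)
      assume "P m \<noteq> 0"
      then have m: "m \<in> S" by (simp add: S_def)
      \<comment> \<open>Each coefficient of \<open>P\<close> reappears in the slice for its exponent
        at \<open>x\<close>.\<close>
      define j where "j = count m x"
      have "x \<notin># m - replicate_mset j x"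
        by (simp add: j_def not_in_iff)
      then have "Q j (m - replicate_mset j x) = P (m - replicate_mset j x + replicate_mset j x)"
        by (simp add: Q_def)
      also have "m - replicate_mset j x + replicate_mset j x = m"
        by (auto simp: multiset_eq_iff j_def)
      finally show False
        using Q0[of j] N[OF m] \<open>P m \<noteq> 0\<close> by (simp add: j_def)
    qed
    then show ?thesis by auto
  qed
  then show ?thesis
    unfolding L.algebraically_independent_def by (auto simp: indexed_const_zero_type)
qed

lemma transcendence_base_algebraic_extension:
  fixes K :: "'a::field set"
  assumes K: "subfield K L" and base: "L.transcendence_base K \<Delta>"
  shows "L.algebraic_extension (generate_field L (K \<union> \<Delta>))"
  unfolding L.algebraic_extension_def
proof (rule ballI, rule ccontr)
  fix x :: 'a
  define F where "F = generate_field L (K \<union> \<Delta>)"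
  assume "\<not> (L.algebraic over generate_field L (K \<union> \<Delta>)) x"
  then have not_alg: "\<not> (L.algebraic over F) x" unfolding F_def by blast
  have F: "subfield F L" "K \<union> \<Delta> \<subseteq> F"
    unfolding F_def by (auto intro: L.generate_field_is_subfield generate_field.incl)
  have "L.algebraically_independent K (insert x \<Delta>)"
    using not_alg base unfolding algebraic_over_type_iff[OF F(1)] L.transcendence_base_def
    by (intro algebraically_independent_insert[OF K F]) auto
  \<comment> \<open>Maximality of the base forces
    \<open>insert x \<Delta> = \<Delta>\<close>.\<close>
  then have "x \<in> \<Delta>"
    using base unfolding L.transcendence_base_def by blast
  then have "(L.algebraic over F) x"
    using F(2) by (intro L.algebraic_self subfieldE(1)[OF F(1)]) auto
  then show False using not_alg by blast
qed

text \<open>Elements of \<open>F\<close> are fixed by definition of the group, so it suffices to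
  move each \<open>x\<close> outside \<open>F\<close>.\<close>

lemma galois_extension_if_algebraic:
  fixes F :: "'a::{alg_closed_field, field_char_0} set"
  assumes F: "subfield F L" and alg: "L.algebraic_extension F"
  shows "L.galois_extension F"
proof -
  have "\<exists>\<sigma> \<in> L.galois_group F. \<sigma> x \<noteq> x" if x: "x \<notin> F" for x
  proof -
    have "\<exists>p \<in> polys_over F. p \<noteq> 0 \<and> poly p x = 0" for x
      using alg unfolding L.algebraic_extension_def algebraic_over_type_iff[OF F, symmetric] by simp
    then obtain \<sigma> where \<sigma>: "bij \<sigma>" "\<And>a b. \<sigma> (a + b) = \<sigma> a + \<sigma> b" "\<And>a b. \<sigma> (a * b) = \<sigma> a * \<sigma> b"
      "\<And>c. c \<in> F \<Longrightarrow> \<sigma> c = c" "\<sigma> x \<noteq> x"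
      using exists_automorphism_moving[OF subfield_type_closed[OF F] _ x] by metis
    have "\<sigma> \<in> ring_iso L L"
      using \<sigma>(1-4) subfield_type_closed(2)[OF F] by (intro ring_iso_memI) auto
    then show ?thesis
      using \<sigma>(4,5) unfolding L.galois_group_def by blast
  qed
  then show ?thesis
    unfolding L.galois_extension_def by (auto simp: L.galois_group_def)
qed

end

theorem theorem3p7:
  fixes K :: "complex set"
  assumes "subfield K complex_field" and "\<rat> \<subseteq> K"
  shows "ring.sigma_tame_galois complex_field K"
proof -
  interpret C: field complex_field by rule
  have "subfield (generate_field complex_field (K \<union> \<Delta>)) complex_field" for \<Delta>
    by (rule C.generate_field_is_subfield) simp
  \<comment> \<open>The complex numbers are algebraically closed of characteristic 0, so
    algebraicity over the generated field already yields the Galois property.\<close>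
  then show ?thesis
    unfolding C.sigma_tame_galois_def
    using transcendence_base_algebraic_extension[OF assms(1)] galois_extension_if_algebraic by blast
qed

end
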